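(* Let $Q$ be a complete normed linear space, let $P\subseteq Q$ be nonempty, closed and convex, and let $R:P\to P$ be a weak contraction with constants $\zeta\in(0,1)$ and $L\ge 0$, that is, $$\|Rp-Rq\|\le \zeta\|p-q\|+L\|q-Rp\|\quad\text{for all }p,q\in P,$$ which in addition satisfies $$\|Rp-Rq\|\le \zeta\|p-q\|+L\|p-Rp\|\quad\text{for all }p,q\in P.$$ Let $s$ denote the unique fixed point of $R$ in $P$, and let $(a_m)_{m\ge0}$ be a sequence in $(0,1)$. Then the $AT$ iterative algorithm for $R$ with control sequence $(a_m)$ is almost $R$-stable.
   Context: $\mathbb{Z}_+$ denotes the set of nonnegative integers. The $AT$ iterative algorithm for a self-map $R$ of $P$, with control sequence $(a_m)$ in $(0,1)$ and initial point $s_0\in P$, is defined for $m\in\mathbb{Z}_+$ by $$b_m=\tfrac12 R^2(s_m)+\tfrac12 R^2\big((1-a_m)s_m+a_mRs_m\big),\qquad s_{m+1}=R\big((1-a_m)b_m+a_mRb_m\big),$$ where $R^2=R\circ R$. Write this as $s_{m+1}=g(R,s_m)$; so at step $m$, for $r\in P$, $$g(R,r)=R\big((1-a_m)b+a_mRb\big),\qquad b=\tfrac12R^2(r)+\tfrac12R^2\big((1-a_m)r+a_mRr\big).$$ Almost $R$-stability: for a sequence $\{r_m\}$ in $P$ put $\gamma_m=\|r_{m+1}-g(R,r_m)\|$, $m\in\mathbb{Z}_+$ (with $g$ evaluated at step $m$). The iterative method $s_{m+1}=g(R,s_m)$ is almost $R$-stable (with respect to the fixed point $s$ of $R$) if for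 every sequence $\{r_m\}$ in $P$, $$\sum_{m=0}^\infty\gamma_m<\infty\ \Longrightarrow\ \lim_{m\to\infty}r_m=s.$$ It is a known fact that a map satisfying the two displayed inequalities on a complete space has a unique fixed point, so $s$ is well defined. *)

theory Defs
  imports "HOL-Analysis.Analysis"
begin

definition weak_contraction_on ::
    "'a::real_normed_vector set \<Rightarrow> real \<Rightarrow> real \<Rightarrow> ('a \<Rightarrow> 'a) \<Rightarrow> bool" where
  "weak_contraction_on P \<zeta> L R \<longleftrightarrow>
     0 < \<zeta> \<and> \<zeta> < 1 \<and> 0 \<le> L \<and>
     (\<forall>p\<in>P. \<forall>q\<in>P. norm (R p - R q) \<le> \<zeta> * norm (p - q) + L * norm (q - R p))"

(* The AT algorithm with control sequence a is s (Suc m) = AT_step a R m (s m). *)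
definition AT_step ::
    "(nat \<Rightarrow> real) \<Rightarrow> ('a::real_vector \<Rightarrow> 'a) \<Rightarrow> nat \<Rightarrow> 'a \<Rightarrow> 'a" where
  "AT_step a R m r =
     (let b = (1/2) *\<^sub>R R (R r)
            + (1/2) *\<^sub>R R (R ((1 - a m) *\<^sub>R r + a m *\<^sub>R R r))
      in R ((1 - a m) *\<^sub>R b + a m *\<^sub>R R b))"

(* g R m is the m-th step of the iterative method for the map R;
   s is meant to be the fixed point of R in P. *)
definition almost_stable_on ::
    "'a::real_normed_vector set \<Rightarrow> (('a \<Rightarrow> 'a) \<Rightarrow> nat \<Rightarrow> 'a \<Rightarrow> 'a) \<Rightarrow> ('a \<Rightarrow> 'a) \<Rightarrow> 'a \<Rightarrow> bool" where
  "almost_stable_on P g R s \<longleftrightarrow>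
     (\<forall>r. (\<forall>m. r m \<in> P) \<longrightarrow> summable (\<lambda>m. norm (r (Suc m) - g R m (r m))) \<longrightarrow>
          r \<longlonglongrightarrow> s)"

end

theory Submission
  imports Defs
begin

text \<open>
  In the inequality with \<open>L * norm (p - R p)\<close>, let \<open>p\<close> be a fixed point \<open>s\<close>. The \<open>L\<close>-term disappears
  and \<open>norm (s - R q) \<le> \<zeta> * norm (s - q)\<close> remains: the map \<open>R\<close> pulls every point of \<open>P\<close> towards \<open>s\<close>,
  although it may be discontinuous elsewhere. A step of the AT algorithm is made of convex combinations, which do
  not leave a ball around \<open>s\<close>, and of applications of \<open>R\<close>, the last of which shrinks the ball; so the
  whole step brings the point nearer to \<open>s\<close> by the factor \<open>\<zeta>\<close>, whatever the control sequence
  (\<open>AT_step_contracts_towards\<close>). Along an inexact orbit with errors \<open>\<gamma> m\<close>, the distances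
  \<open>e m = norm (r m - s)\<close> therefore satisfy \<open>e (m + 1) \<le> \<zeta> * e m + \<gamma> m\<close>, and summability of the errors
  forces summability of the distances (\<open>summable_perturbed_contraction\<close>).

  The description of \<open>s\<close> denotes a fixed point because there is exactly one. Two fixed points coincide
  since each is pulled towards the other by the factor \<open>\<zeta> < 1\<close>. Existence rests on the weak
  contraction property (\<open>weak_contraction_has_fixed_point\<close>).
\<close>

text \<open>
  Summing the recursion over \<open>m < N\<close> bounds the partial sum \<open>S N\<close> by
  \<open>e 0 + \<zeta> * S N + suminf \<gamma>\<close>; solving for \<open>S N\<close> gives a bound that does not depend on \<open>N\<close>.
\<close>

lemma summable_perturbed_contraction:
  fixes e \<gamma> :: "nat \<Rightarrow> real"
  assumes e_nonneg: "\<And>m. 0 \<le> e m" and \<gamma>_nonneg: "\<And>m. 0 \<le> \<gamma> m" and "summable \<gamma>" and "\<zeta> < 1"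
    and step: "\<And>m. e (Suc m) \<le> \<zeta> * e m + \<gamma> m"
  shows "summable e"
proof (rule summableI_nonneg_bounded)
  show "0 \<le> e m" for m by (rule e_nonneg)
  show "(\<Sum>m<N. e m) \<le> (e 0 + suminf \<gamma>) / (1 - \<zeta>)" for N
  proof -
    have "(\<Sum>m<N. e m) \<le> (\<Sum>m<Suc N. e m)"
      using e_nonneg by simp
    also have "\<dots> = e 0 + (\<Sum>m<N. e (Suc m))"
      by (rule sum.lessThan_Suc_shift)
    also have "(\<Sum>m<N. e (Suc m)) \<le> (\<Sum>m<N. \<zeta> * e m + \<gamma> m)"
      by (rule sum_mono) (rule step)
    also have "\<dots> = \<zeta> * (\<Sum>m<N. e m) + (\<Sum>m<N. \<gamma> m)"
      by (simp add: sum.distrib sum_distrib_left)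
    also have "(\<Sum>m<N. \<gamma> m) \<le> suminf \<gamma>"
      using \<open>summable \<gamma>\<close> \<gamma>_nonneg by (intro sum_le_suminf) auto
    finally have "(1 - \<zeta>) * (\<Sum>m<N. e m) \<le> e 0 + suminf \<gamma>"
      by (simp add: algebra_simps)
    with \<open>\<zeta> < 1\<close> show ?thesis
      by (simp add: field_simps)
  qed
qed

text \<open>
  With \<open>q = R p\<close> the \<open>L\<close>-term of a weak contraction vanishes, so the distances of successive Picard
  iterates decay geometrically. With \<open>p\<close> an iterate and \<open>q\<close> the limit \<open>y\<close>, both terms on the right tend
  to \<open>0\<close>; this replaces continuity of \<open>R\<close> in the proof that \<open>R y = y\<close>.
\<close>

lemma weak_contraction_has_fixed_point:
  fixes P :: "'a::banach set"
  assumes "P \<noteq> {}" and "closed P" and "R \<in> P \<rightarrow> P" and "weak_contraction_on P \<zeta> L R"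
  shows "\<exists>x\<in>P. R x = x"
proof -
  have "\<zeta> < 1"
    using assms(4) by (simp add: weak_contraction_on_def)
  have weak: "norm (R p - R q) \<le> \<zeta> * norm (p - q) + L * norm (q - R p)"
    if "p \<in> P" "q \<in> P" for p q
    using assms(4) that by (simp add: weak_contraction_on_def)
  obtain x\<^sub>0 where "x\<^sub>0 \<in> P"
    using \<open>P \<noteq> {}\<close> by blast
  define x where "x n = (R ^^ n) x\<^sub>0" for n
  have x_Suc: "x (Suc n) = R (x n)" for n
    by (simp add: x_def)
  have x_in_P: "x n \<in> P" for n
    using \<open>x\<^sub>0 \<in> P\<close> \<open>R \<in> P \<rightarrow> P\<close> by (induction n) (auto simp: x_def)
  \<comment> \<open>The summand \<open>0\<close> makes this the recursion of a perturbed contraction with zero errors.\<close>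
  have step: "norm (x (Suc (Suc n)) - x (Suc n)) \<le> \<zeta> * norm (x (Suc n) - x n) + 0" for n
    using weak[OF x_in_P x_in_P, of n "Suc n"] by (simp add: x_Suc norm_minus_commute)
  have "summable (\<lambda>n. norm (x (Suc n) - x n))"
    by (rule summable_perturbed_contraction[where e = "\<lambda>n. norm (x (Suc n) - x n)",
          OF norm_ge_zero order_refl summable_zero \<open>\<zeta> < 1\<close> step])
  then have "summable (\<lambda>n. x (Suc n) - x n)"
    by (rule summable_norm_cancel)
  then obtain d where "(\<lambda>n. \<Sum>k<n. x (Suc k) - x k) \<longlonglongrightarrow> d"
    using summable_LIMSEQ by blast
  then have "(\<lambda>n. x n - x 0) \<longlonglongrightarrow> d"
    by (simp add: sum_lessThan_telescope)
  from tendsto_add[OF this tendsto_const[of "x 0"]] obtain y where x_lim: "x \<longlonglongrightarrow> y"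
    by simp
  have x_Suc_lim: "(\<lambda>n. x (Suc n)) \<longlonglongrightarrow> y"
    using x_lim by (rule LIMSEQ_Suc)
  have "y \<in> P"
    using \<open>closed P\<close> x_in_P x_lim by (rule closed_sequentially)
  have "(\<lambda>n. x (Suc n)) \<longlonglongrightarrow> R y"
  proof -
    have "(\<lambda>n. \<zeta> * norm (x n - y) + L * norm (y - x (Suc n)))
            \<longlonglongrightarrow> \<zeta> * norm (y - y) + L * norm (y - y)"
      by (intro tendsto_intros x_lim x_Suc_lim)
    then have bound_lim: "(\<lambda>n. \<zeta> * norm (x n - y) + L * norm (y - x (Suc n))) \<longlonglongrightarrow> 0"
      by simp
    have "norm (x (Suc n) - R y) \<le> \<zeta> * norm (x n - y) + L * norm (y - x (Suc n))" for n
      using weak[OF x_in_P \<open>y \<in> P\<close>, of n] by (simp add: x_Suc)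
    then have "\<forall>\<^sub>F n in sequentially.
        norm (x (Suc n) - R y) \<le> \<zeta> * norm (x n - y) + L * norm (y - x (Suc n))"
      by (rule always_eventually[OF allI])
    then have "(\<lambda>n. x (Suc n) - R y) \<longlonglongrightarrow> 0"
      using bound_lim by (rule Lim_null_comparison)
    then show ?thesis
      by (rule LIM_zero_cancel)
  qed
  then have "R y = y"
    using x_Suc_lim by (rule LIMSEQ_unique)
  with \<open>y \<in> P\<close> show ?thesis
    by blast
qed

text \<open>
  The part of \<open>P\<close> that is at most as far from \<open>s\<close> as the current point is convex and invariant under \<open>R\<close>,
  so the auxiliary point \<open>b\<close> and its average with \<open>R b\<close> stay in it. The outermost \<open>R\<close> then gains the
  factor \<open>\<zeta>\<close>.
\<close>

lemma AT_step_contracts_towards: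
  fixes P :: "'a::real_normed_vector set"
  assumes "convex P" and "R \<in> P \<rightarrow> P" and "0 \<le> \<zeta>" and "\<zeta> \<le> 1" and "a m \<in> {0..1}"
    and towards: "\<And>q. q \<in> P \<Longrightarrow> norm (R q - s) \<le> \<zeta> * norm (q - s)"
    and "r \<in> P"
  shows "norm (AT_step a R m r - s) \<le> \<zeta> * norm (r - s)"
proof -
  define K where "K = P \<inter> cball s (norm (r - s))"
  have "convex K"
    unfolding K_def using \<open>convex P\<close> by (intro convex_Int convex_cball)
  have "r \<in> K"
    using \<open>r \<in> P\<close> by (simp add: K_def dist_norm norm_minus_commute)
  have R_shrinks: "norm (R q - s) \<le> \<zeta> * norm (r - s)" if "q \<in> K" for q
  proof -
    have "norm (R q - s) \<le> \<zeta> * norm (q - s)"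
      by (rule towards) (use that in \<open>simp add: K_def\<close>)
    also have "\<dots> \<le> \<zeta> * norm (r - s)"
      using that \<open>0 \<le> \<zeta>\<close>
      by (intro mult_left_mono) (simp_all add: K_def dist_norm norm_minus_commute)
    finally show ?thesis .
  qed
  have R_in_K: "R q \<in> K" if "q \<in> K" for q
  proof -
    have "norm (R q - s) \<le> 1 * norm (r - s)"
      using R_shrinks[OF that] mult_right_mono[OF \<open>\<zeta> \<le> 1\<close> norm_ge_zero] by (rule order_trans)
    then show ?thesis
      using that \<open>R \<in> P \<rightarrow> P\<close> by (auto simp: K_def dist_norm norm_minus_commute)
  qed
  have average_in_K: "(1 - a m) *\<^sub>R q + a m *\<^sub>R R q \<in> K" if "q \<in> K" for q
    using \<open>convex K\<close> that R_in_K[OF that] \<open>a m \<in> {0..1}\<close> by (intro convexD) auto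
  define b where
    "b = (1/2) *\<^sub>R R (R r) + (1/2) *\<^sub>R R (R ((1 - a m) *\<^sub>R r + a m *\<^sub>R R r))"
  have "b \<in> K"
    unfolding b_def using \<open>r \<in> K\<close>
    by (intro convexD[OF \<open>convex K\<close>] R_in_K average_in_K) auto
  then show ?thesis
    using R_shrinks[OF average_in_K] by (simp add: AT_step_def b_def Let_def)
qed

theorem theorem3:
  fixes P :: "'a::banach set" and R :: "'a \<Rightarrow> 'a"
    and \<zeta> L :: real and a :: "nat \<Rightarrow> real" and s :: 'a
  assumes "P \<noteq> {}" and "closed P" and "convex P"
    and "R \<in> P \<rightarrow> P"
    and "weak_contraction_on P \<zeta> L R"
    and "\<And>p q. p \<in> P \<Longrightarrow> q \<in> P \<Longrightarrow>
           norm (R p - R q) \<le> \<zeta> * norm (p - q) + L * norm (p - R p)"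
    and "s = (THE x. x \<in> P \<and> R x = x)"
    and "\<And>m. a m \<in> {0<..<1}"
  shows "almost_stable_on P (AT_step a) R s"
proof -
  have "0 < \<zeta>" "\<zeta> < 1"
    using assms(5) by (auto simp: weak_contraction_on_def)
  have towards: "norm (R q - x) \<le> \<zeta> * norm (q - x)" if "x \<in> P" "R x = x" "q \<in> P" for x q
    using assms(6)[OF \<open>x \<in> P\<close> \<open>q \<in> P\<close>] \<open>R x = x\<close> by (simp add: norm_minus_commute)
  have unique: "x = y" if "x \<in> P" "R x = x" "y \<in> P" "R y = y" for x y
  proof -
    have "(1 - \<zeta>) * norm (y - x) \<le> 0"
      using towards[OF that(1,2,3)] \<open>R y = y\<close> by (simp add: algebra_simps)
    then show ?thesis
      using \<open>\<zeta> < 1\<close> by (simp add: mult_le_0_iff)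
  qed
  have "\<exists>!x. x \<in> P \<and> R x = x"
    using weak_contraction_has_fixed_point[OF assms(1,2,4,5)] unique by blast
  then have "s \<in> P \<and> R s = s"
    unfolding assms(7) by (rule theI')
  then have "s \<in> P" and "R s = s"
    by auto
  show ?thesis
    unfolding almost_stable_on_def
  proof (intro allI impI)
    fix r
    assume r_in_P: "\<forall>m. r m \<in> P"
      and errors: "summable (\<lambda>m. norm (r (Suc m) - AT_step a R m (r m)))"
    have step: "norm (r (Suc m) - s) \<le> \<zeta> * norm (r m - s) + norm (r (Suc m) - AT_step a R m (r m))" for m
    proof -
      have "norm (AT_step a R m (r m) - s) \<le> \<zeta> * norm (r m - s)"
      proof (rule AT_step_contracts_towards[OF assms(3,4)])
        show "a m \<in> {0..1}"
          using assms(8)[of m] by simp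
      qed (use r_in_P \<open>0 < \<zeta>\<close> \<open>\<zeta> < 1\<close> towards[OF \<open>s \<in> P\<close> \<open>R s = s\<close>] in auto)
      moreover have "norm (r (Suc m) - s)
          \<le> norm (r (Suc m) - AT_step a R m (r m)) + norm (AT_step a R m (r m) - s)"
        using norm_triangle_ineq[of "r (Suc m) - AT_step a R m (r m)" "AT_step a R m (r m) - s"]
        by simp
      ultimately show ?thesis
        by linarith
    qed
    have "summable (\<lambda>m. norm (r m - s))"
      by (rule summable_perturbed_contraction[where e = "\<lambda>m. norm (r m - s)",
            OF norm_ge_zero norm_ge_zero errors \<open>\<zeta> < 1\<close> step])
    then have "(\<lambda>m. norm (r m - s)) \<longlonglongrightarrow> 0"
      by (rule summable_LIMSEQ_zero)
    then show "r \<longlonglongrightarrow> s"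
      by (simp add: tendsto_norm_zero_iff LIM_zero_iff)
  qed
qed

end
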